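(* Let $(M,\omega,\eta)$ be a cosymplectic manifold and let $\xi$ be its Reeb vector field. (1) If $\phi\in G_{\eta,\omega}(M)$, then $\phi_\ast(\xi)=\xi$. (2) If $\psi\in\mathcal AG_{\eta,\omega}(M)$ with $\psi^\ast(\eta)=e^f\eta$, then $\psi_\ast(\xi)=e^{f\circ\psi^{-1}}\xi$.
   Context: A cosymplectic manifold $(M,\omega,\eta)$ is a manifold with a closed $2$-form $\omega$ and a closed $1$-form $\eta$, nowhere zero, such that $\widetilde I_{\eta,\omega}:X\mapsto \imath_X\omega+\eta(X)\eta$ is a (pointwise) isomorphism from vector fields to $1$-forms. The Reeb vector field is $\xi:=\widetilde I_{\eta,\omega}^{-1}(\eta)$, characterized by $\eta(\xi)=1$ and $\imath_\xi\omega=0$. A diffeomorphism $\phi$ of $M$ is cosymplectic if $\phi^*\omega=\omega$ and $\phi^*\eta=\eta$; it is almost cosymplectic if $\phi^*\omega=\omega$ and $\phi^*\eta=e^f\eta$ for some $f\in C^\infty(M)$. An isotopy $\{\phi_t\}_{t\in[0,1]}$ (smooth, $\phi_0=\mathrm{id}_M$) is cosymplectic (resp. almost cosymplectic) if every $\phi_t$ is. $G_{\eta,\omega}(M)$ (resp. $\mathcal AG_{\eta,\omega}(M)$) is the set of time-one maps of cosymplectic (resp. almost cosymplectic) isotopies. $\phi_\ast(X)=d\phi\circ X\circ\phi^{-1}$ is the push-forward of a vector field. *)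

theory Defs
  imports "HOL-Analysis.Analysis" "HOL-Library.FuncSet"
begin

section \<open>Smooth maps between Euclidean spaces\<close>

text \<open>On an open set \<open>S\<close> of a finite-dimensional space this is the class \<open>C\<^sup>k\<close>.\<close>

primrec Ck_open :: "nat \<Rightarrow> 'e::euclidean_space set \<Rightarrow> ('e \<Rightarrow> 'f::real_normed_vector) \<Rightarrow> bool" where
  "Ck_open 0 S g \<longleftrightarrow> continuous_on S g"
| "Ck_open (Suc k) S g \<longleftrightarrow>
     (\<forall>x\<in>S. g differentiable (at x)) \<and>
     (\<forall>v. Ck_open k S (\<lambda>x. frechet_derivative g (at x) v))"

text \<open>Smoothness on an arbitrary set means local extendability to a smooth map on an open set.
  For open \<open>S\<close> this is ordinary smoothness; the general case is needed for \<open>[0,1] \<times> M\<close>.\<close>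

definition smooth_on :: "'e::euclidean_space set \<Rightarrow> ('e \<Rightarrow> 'f::real_normed_vector) \<Rightarrow> bool" where
  "smooth_on S g \<longleftrightarrow>
     (\<forall>x\<in>S. \<exists>W h. open W \<and> x \<in> W \<and> (\<forall>k. Ck_open k W h) \<and> (\<forall>y\<in>S \<inter> W. h y = g y))"


section \<open>Smooth manifolds\<close>

text \<open>The manifold is the whole type \<open>'a\<close>, a Hausdorff second countable space; its smooth
  structure is given by an atlas of charts \<open>(U, x)\<close> with values in \<open>\<real>\<^sup>n\<close>, \<open>n = CARD('n)\<close>.
  The atlas need not be maximal.\<close>

type_synonym ('a, 'n) chart = "'a set \<times> ('a \<Rightarrow> real ^ 'n)"

definition chart_inv :: "('a, 'n) chart \<Rightarrow> real ^ 'n \<Rightarrow> 'a" where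
  "chart_inv c = inv_into (fst c) (snd c)"

definition smooth_atlas ::
  "('a::{t2_space, second_countable_topology}, 'n::finite) chart set \<Rightarrow> bool" where
  "smooth_atlas A \<longleftrightarrow>
     (\<forall>c\<in>A. open (fst c) \<and> open (snd c ` fst c) \<and>
            homeomorphism (fst c) (snd c ` fst c) (snd c) (chart_inv c)) \<and>
     (\<Union>c\<in>A. fst c) = UNIV \<and>
     (\<forall>c\<in>A. \<forall>d\<in>A. smooth_on (snd c ` (fst c \<inter> fst d)) (snd d \<circ> chart_inv c))"

definition smooth_fun :: "('a, 'n::finite) chart set \<Rightarrow> ('a \<Rightarrow> real) \<Rightarrow> bool" where
  "smooth_fun A f \<longleftrightarrow> (\<forall>c\<in>A. smooth_on (snd c ` fst c) (f \<circ> chart_inv c))"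

definition smooth_self_map ::
  "('a::topological_space, 'n::finite) chart set \<Rightarrow> ('a \<Rightarrow> 'a) \<Rightarrow> bool" where
  "smooth_self_map A \<phi> \<longleftrightarrow>
     continuous_on UNIV \<phi> \<and>
     (\<forall>c\<in>A. \<forall>d\<in>A. smooth_on (snd c ` (fst c \<inter> \<phi> -` fst d)) (snd d \<circ> \<phi> \<circ> chart_inv c))"

definition diffeomorphism ::
  "('a::topological_space, 'n::finite) chart set \<Rightarrow> ('a \<Rightarrow> 'a) \<Rightarrow> bool" where
  "diffeomorphism A \<phi> \<longleftrightarrow> bij \<phi> \<and> smooth_self_map A \<phi> \<and> smooth_self_map A (inv \<phi>)"


section \<open>Tangent vectors and differentials\<close>

text \<open>A tangent vector at \<open>p\<close> assigns to every chart around \<open>p\<close> a coordinate vector, such that the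
  coordinate vectors are related by the Jacobians of the transition maps.  The value \<open>0\<close> at all
  other arguments is a normalisation that makes equality of tangent vectors equality of functions.\<close>

type_synonym ('a, 'n) tvec = "('a, 'n) chart \<Rightarrow> real ^ 'n"

definition tangent_space :: "('a, 'n::finite) chart set \<Rightarrow> 'a \<Rightarrow> ('a, 'n) tvec set" where
  "tangent_space A p =
     {v. (\<forall>c. \<not> (c \<in> A \<and> p \<in> fst c) \<longrightarrow> v c = 0) \<and>
         (\<forall>c\<in>A. \<forall>d\<in>A. p \<in> fst c \<and> p \<in> fst d \<longrightarrow>
            v d = frechet_derivative (snd d \<circ> chart_inv c) (at (snd c p)) (v c))}"

text \<open>The tangent vector at \<open>p\<close> with coordinate vector \<open>w\<close> in the chart \<open>c\<close>.\<close>

definition coord_vec ::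
  "('a, 'n::finite) chart set \<Rightarrow> ('a, 'n) chart \<Rightarrow> 'a \<Rightarrow> real ^ 'n \<Rightarrow> ('a, 'n) tvec" where
  "coord_vec A c p w =
     (\<lambda>d. if d \<in> A \<and> p \<in> fst d
          then frechet_derivative (snd d \<circ> chart_inv c) (at (snd c p)) w else 0)"

text \<open>By the chain rule, the following does not depend on the choice of the chart \<open>c\<close>.\<close>

definition differential ::
  "('a, 'n::finite) chart set \<Rightarrow> ('a \<Rightarrow> 'a) \<Rightarrow> 'a \<Rightarrow> ('a, 'n) tvec \<Rightarrow> ('a, 'n) tvec" where
  "differential A \<phi> p v =
     (let c = (SOME c. c \<in> A \<and> p \<in> fst c) in
      (\<lambda>d. if d \<in> A \<and> \<phi> p \<in> fst d
           then frechet_derivative (snd d \<circ> \<phi> \<circ> chart_inv c) (at (snd c p)) (v c) else 0))"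

definition push_forward ::
  "('a, 'n::finite) chart set \<Rightarrow> ('a \<Rightarrow> 'a) \<Rightarrow> ('a \<Rightarrow> ('a, 'n) tvec) \<Rightarrow> ('a \<Rightarrow> ('a, 'n) tvec)" where
  "push_forward A \<phi> X = (\<lambda>p. differential A \<phi> (inv \<phi> p) (X (inv \<phi> p)))"


section \<open>Differential forms\<close>

text \<open>Covectors and forms are extensional (\<open>undefined\<close> off the tangent space), so that equality of
  forms is equality of functions.\<close>

definition cotangent_space ::
  "('a, 'n::finite) chart set \<Rightarrow> 'a \<Rightarrow> (('a, 'n) tvec \<Rightarrow> real) set" where
  "cotangent_space A p =
     {\<alpha> \<in> extensional (tangent_space A p).
        \<forall>u\<in>tangent_space A p. \<forall>v\<in>tangent_space A p. \<forall>a b.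
          \<alpha> (\<lambda>c. a *\<^sub>R u c + b *\<^sub>R v c) = a * \<alpha> u + b * \<alpha> v}"

text \<open>Coefficients of a 1-form and of a 2-form in a chart, on constant vectors \<open>u\<close>, \<open>v\<close>.\<close>

definition local_form1 ::
  "('a, 'n::finite) chart set \<Rightarrow> ('a, 'n) chart \<Rightarrow> ('a \<Rightarrow> ('a, 'n) tvec \<Rightarrow> real) \<Rightarrow>
   real ^ 'n \<Rightarrow> real ^ 'n \<Rightarrow> real" where
  "local_form1 A c \<alpha> u z = (let p = chart_inv c z in \<alpha> p (coord_vec A c p u))"

definition local_form2 ::
  "('a, 'n::finite) chart set \<Rightarrow> ('a, 'n) chart \<Rightarrow>
   ('a \<Rightarrow> ('a, 'n) tvec \<Rightarrow> ('a, 'n) tvec \<Rightarrow> real) \<Rightarrow>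
   real ^ 'n \<Rightarrow> real ^ 'n \<Rightarrow> real ^ 'n \<Rightarrow> real" where
  "local_form2 A c \<omega> u v z =
     (let p = chart_inv c z in \<omega> p (coord_vec A c p u) (coord_vec A c p v))"

definition one_form ::
  "('a, 'n::finite) chart set \<Rightarrow> ('a \<Rightarrow> ('a, 'n) tvec \<Rightarrow> real) \<Rightarrow> bool" where
  "one_form A \<alpha> \<longleftrightarrow>
     (\<forall>p. \<alpha> p \<in> cotangent_space A p) \<and>
     (\<forall>c\<in>A. \<forall>u. smooth_on (snd c ` fst c) (local_form1 A c \<alpha> u))"

definition two_form ::
  "('a, 'n::finite) chart set \<Rightarrow> ('a \<Rightarrow> ('a, 'n) tvec \<Rightarrow> ('a, 'n) tvec \<Rightarrow> real) \<Rightarrow> bool" where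
  "two_form A \<omega> \<longleftrightarrow>
     (\<forall>p. \<omega> p \<in> extensional (tangent_space A p) \<and>
          (\<forall>u\<in>tangent_space A p. \<omega> p u \<in> cotangent_space A p) \<and>
          (\<forall>u\<in>tangent_space A p. \<forall>v\<in>tangent_space A p. \<omega> p u v = - \<omega> p v u)) \<and>
     (\<forall>c\<in>A. \<forall>u v. smooth_on (snd c ` fst c) (local_form2 A c \<omega> u v))"

text \<open>Vanishing of the exterior derivative, which on constant vector fields of a chart is
  \<open>d\<alpha>(u,v) = D\<^sub>u \<alpha>(v) - D\<^sub>v \<alpha>(u)\<close> and
  \<open>d\<omega>(u,v,w) = D\<^sub>u \<omega>(v,w) - D\<^sub>v \<omega>(u,w) + D\<^sub>w \<omega>(u,v)\<close>.\<close>

definition closed_one_form ::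
  "('a, 'n::finite) chart set \<Rightarrow> ('a \<Rightarrow> ('a, 'n) tvec \<Rightarrow> real) \<Rightarrow> bool" where
  "closed_one_form A \<alpha> \<longleftrightarrow> one_form A \<alpha> \<and>
     (\<forall>c\<in>A. \<forall>z\<in>snd c ` fst c. \<forall>u v.
        frechet_derivative (local_form1 A c \<alpha> v) (at z) u
        - frechet_derivative (local_form1 A c \<alpha> u) (at z) v = 0)"

definition closed_two_form ::
  "('a, 'n::finite) chart set \<Rightarrow> ('a \<Rightarrow> ('a, 'n) tvec \<Rightarrow> ('a, 'n) tvec \<Rightarrow> real) \<Rightarrow> bool" where
  "closed_two_form A \<omega> \<longleftrightarrow> two_form A \<omega> \<and>
     (\<forall>c\<in>A. \<forall>z\<in>snd c ` fst c. \<forall>u v w.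
        frechet_derivative (local_form2 A c \<omega> v w) (at z) u
        - frechet_derivative (local_form2 A c \<omega> u w) (at z) v
        + frechet_derivative (local_form2 A c \<omega> u v) (at z) w = 0)"

definition pull_back1 ::
  "('a, 'n::finite) chart set \<Rightarrow> ('a \<Rightarrow> 'a) \<Rightarrow> ('a \<Rightarrow> ('a, 'n) tvec \<Rightarrow> real) \<Rightarrow>
   ('a \<Rightarrow> ('a, 'n) tvec \<Rightarrow> real)" where
  "pull_back1 A \<phi> \<alpha> = (\<lambda>p. \<lambda>v\<in>tangent_space A p. \<alpha> (\<phi> p) (differential A \<phi> p v))"

definition pull_back2 ::
  "('a, 'n::finite) chart set \<Rightarrow> ('a \<Rightarrow> 'a) \<Rightarrow>
   ('a \<Rightarrow> ('a, 'n) tvec \<Rightarrow> ('a, 'n) tvec \<Rightarrow> real) \<Rightarrow>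
   ('a \<Rightarrow> ('a, 'n) tvec \<Rightarrow> ('a, 'n) tvec \<Rightarrow> real)" where
  "pull_back2 A \<phi> \<omega> = (\<lambda>p. \<lambda>u\<in>tangent_space A p. \<lambda>v\<in>tangent_space A p.
     \<omega> (\<phi> p) (differential A \<phi> p u) (differential A \<phi> p v))"

definition fun_times_form1 ::
  "('a, 'n::finite) chart set \<Rightarrow> ('a \<Rightarrow> real) \<Rightarrow> ('a \<Rightarrow> ('a, 'n) tvec \<Rightarrow> real) \<Rightarrow>
   ('a \<Rightarrow> ('a, 'n) tvec \<Rightarrow> real)" where
  "fun_times_form1 A g \<alpha> = (\<lambda>p. \<lambda>v\<in>tangent_space A p. g p * \<alpha> p v)"

definition fun_times_field ::
  "('a \<Rightarrow> real) \<Rightarrow> ('a \<Rightarrow> ('a, 'n::finite) tvec) \<Rightarrow> ('a \<Rightarrow> ('a, 'n) tvec)" where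
  "fun_times_field g X = (\<lambda>p c. g p *\<^sub>R X p c)"


section \<open>Cosymplectic manifolds\<close>

text \<open>The map \<open>X \<mapsto> \<iota>\<^sub>X \<omega> + \<eta>(X) \<eta>\<close> at the point \<open>p\<close>.\<close>

definition cosymp_map ::
  "('a, 'n::finite) chart set \<Rightarrow> ('a \<Rightarrow> ('a, 'n) tvec \<Rightarrow> ('a, 'n) tvec \<Rightarrow> real) \<Rightarrow>
   ('a \<Rightarrow> ('a, 'n) tvec \<Rightarrow> real) \<Rightarrow> 'a \<Rightarrow> ('a, 'n) tvec \<Rightarrow> (('a, 'n) tvec \<Rightarrow> real)" where
  "cosymp_map A \<omega> \<eta> p u = (\<lambda>v\<in>tangent_space A p. \<omega> p u v + \<eta> p u * \<eta> p v)"

text \<open>Cosymplectic manifolds have odd dimension \<open>2m + 1\<close>.  This has to be required: on \<open>\<real>\<^sup>2\<close> with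
  \<open>\<omega> = dx \<and> dy\<close> and \<open>\<eta> = dx\<close> all other conditions hold, but the vector \<open>\<xi>\<close> with
  \<open>\<iota>\<^sub>\<xi> \<omega> + \<eta>(\<xi>) \<eta> = \<eta>\<close> has \<open>\<eta>(\<xi>) = 0\<close>.  In odd dimension \<open>\<eta>(\<xi>) = 1\<close> and \<open>\<iota>\<^sub>\<xi> \<omega> = 0\<close> follow.
  Linearity of \<open>cosymp_map\<close> is automatic, so that being an isomorphism amounts to bijectivity.\<close>

definition cosymplectic_manifold ::
  "('a::{t2_space, second_countable_topology}, 'n::finite) chart set \<Rightarrow>
   ('a \<Rightarrow> ('a, 'n) tvec \<Rightarrow> ('a, 'n) tvec \<Rightarrow> real) \<Rightarrow> ('a \<Rightarrow> ('a, 'n) tvec \<Rightarrow> real) \<Rightarrow> bool" where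
  "cosymplectic_manifold A \<omega> \<eta> \<longleftrightarrow>
     smooth_atlas A \<and> odd CARD('n) \<and>
     closed_two_form A \<omega> \<and> closed_one_form A \<eta> \<and>
     (\<forall>p. \<exists>v\<in>tangent_space A p. \<eta> p v \<noteq> 0) \<and>
     (\<forall>p. bij_betw (cosymp_map A \<omega> \<eta> p) (tangent_space A p) (cotangent_space A p))"

definition reeb_field ::
  "('a, 'n::finite) chart set \<Rightarrow> ('a \<Rightarrow> ('a, 'n) tvec \<Rightarrow> ('a, 'n) tvec \<Rightarrow> real) \<Rightarrow>
   ('a \<Rightarrow> ('a, 'n) tvec \<Rightarrow> real) \<Rightarrow> ('a \<Rightarrow> ('a, 'n) tvec)" where
  "reeb_field A \<omega> \<eta> = (\<lambda>p. inv_into (tangent_space A p) (cosymp_map A \<omega> \<eta> p) (\<eta> p))"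

definition cosymplectic_diffeo ::
  "('a::topological_space, 'n::finite) chart set \<Rightarrow>
   ('a \<Rightarrow> ('a, 'n) tvec \<Rightarrow> ('a, 'n) tvec \<Rightarrow> real) \<Rightarrow> ('a \<Rightarrow> ('a, 'n) tvec \<Rightarrow> real) \<Rightarrow>
   ('a \<Rightarrow> 'a) \<Rightarrow> bool" where
  "cosymplectic_diffeo A \<omega> \<eta> \<phi> \<longleftrightarrow>
     diffeomorphism A \<phi> \<and> pull_back2 A \<phi> \<omega> = \<omega> \<and> pull_back1 A \<phi> \<eta> = \<eta>"

definition almost_cosymplectic_diffeo ::
  "('a::topological_space, 'n::finite) chart set \<Rightarrow>
   ('a \<Rightarrow> ('a, 'n) tvec \<Rightarrow> ('a, 'n) tvec \<Rightarrow> real) \<Rightarrow> ('a \<Rightarrow> ('a, 'n) tvec \<Rightarrow> real) \<Rightarrow>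
   ('a \<Rightarrow> 'a) \<Rightarrow> bool" where
  "almost_cosymplectic_diffeo A \<omega> \<eta> \<phi> \<longleftrightarrow>
     diffeomorphism A \<phi> \<and> pull_back2 A \<phi> \<omega> = \<omega> \<and>
     (\<exists>f. smooth_fun A f \<and> pull_back1 A \<phi> \<eta> = fun_times_form1 A (\<lambda>p. exp (f p)) \<eta>)"

definition isotopy ::
  "('a::topological_space, 'n::finite) chart set \<Rightarrow> (real \<Rightarrow> 'a \<Rightarrow> 'a) \<Rightarrow> bool" where
  "isotopy A \<Phi> \<longleftrightarrow>
     \<Phi> 0 = id \<and> (\<forall>t\<in>{0..1}. diffeomorphism A (\<Phi> t)) \<and>
     continuous_on ({0..1} \<times> UNIV) (\<lambda>(t, p). \<Phi> t p) \<and>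
     (\<forall>c\<in>A. \<forall>d\<in>A.
        smooth_on {(t, z). t \<in> {0..1} \<and> z \<in> snd c ` fst c \<and> \<Phi> t (chart_inv c z) \<in> fst d}
          (\<lambda>(t, z). snd d (\<Phi> t (chart_inv c z))))"

definition G_cosymp ::
  "('a::topological_space, 'n::finite) chart set \<Rightarrow>
   ('a \<Rightarrow> ('a, 'n) tvec \<Rightarrow> ('a, 'n) tvec \<Rightarrow> real) \<Rightarrow> ('a \<Rightarrow> ('a, 'n) tvec \<Rightarrow> real) \<Rightarrow>
   ('a \<Rightarrow> 'a) set" where
  "G_cosymp A \<omega> \<eta> =
     {\<Phi> 1 | \<Phi>. isotopy A \<Phi> \<and> (\<forall>t\<in>{0..1}. cosymplectic_diffeo A \<omega> \<eta> (\<Phi> t))}"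

definition AG_cosymp ::
  "('a::topological_space, 'n::finite) chart set \<Rightarrow>
   ('a \<Rightarrow> ('a, 'n) tvec \<Rightarrow> ('a, 'n) tvec \<Rightarrow> real) \<Rightarrow> ('a \<Rightarrow> ('a, 'n) tvec \<Rightarrow> real) \<Rightarrow>
   ('a \<Rightarrow> 'a) set" where
  "AG_cosymp A \<omega> \<eta> =
     {\<Phi> 1 | \<Phi>. isotopy A \<Phi> \<and> (\<forall>t\<in>{0..1}. almost_cosymplectic_diffeo A \<omega> \<eta> (\<Phi> t))}"

end

theory Submission
  imports Defs
begin

text \<open>At each point \<open>p\<close> with image \<open>q = \<psi>(p)\<close>, the differential of \<open>\<psi>\<close> maps the tangent space at \<open>p\<close>
  onto the one at \<open>q\<close>, so the pull-back equations say that \<open>d\<psi>(\<xi>\<^sub>p)\<close> annihilates \<open>\<omega>\<^sub>q\<close> and that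
  \<open>\<eta>\<^sub>q(d\<psi>(\<xi>\<^sub>p)) = e\<^bsup>f(p)\<^esup>\<close>.  The vector \<open>e\<^bsup>f(p)\<^esup> \<xi>\<^sub>q\<close> has the same two properties, and they determine
  a vector because \<open>X \<mapsto> \<iota>\<^sub>X \<omega> + \<eta>(X) \<eta>\<close> is injective.  Cosymplectic maps are the case \<open>f = 0\<close>.\<close>

section \<open>Smooth maps in charts and the chain rule\<close>

lemma smooth_on_open_differentiable:
  assumes "smooth_on S g" "open S" "x \<in> S"
  shows "g differentiable (at x)"
proof -
  obtain W h where W: "open W" "x \<in> W" "\<forall>k. Ck_open k W h" "\<forall>y\<in>S \<inter> W. h y = g y"
    using assms unfolding smooth_on_def by blast
  \<comment> \<open>The extension \<open>h\<close> is differentiable on \<open>W\<close> and equals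
    \<open>g\<close> on the open neighbourhood \<open>S \<inter> W\<close> of \<open>x\<close>, so
    its derivative passes to \<open>g\<close>.\<close>
  have "Ck_open (Suc 0) W h"
    using W(3) by blast
  then have "h differentiable (at x)"
    using W(2) by simp
  then have "(h has_derivative frechet_derivative h (at x)) (at x)"
    by (simp add: frechet_derivative_works)
  then have "(g has_derivative frechet_derivative h (at x)) (at x)"
    by (rule has_derivative_transform_within_open[of _ _ _ _ "S \<inter> W"])
      (use W assms in auto)
  then show ?thesis
    by (auto simp: differentiable_def)
qed

lemma chart_inv_snd [simp]:
  assumes "smooth_atlas A" "c \<in> A" "p \<in> fst c"
  shows "chart_inv c (snd c p) = p"
  using assms unfolding smooth_atlas_def homeomorphism_def by blast

text \<open>A chart is a homeomorphism onto an open image, so relatively open images are open. This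
  provides the open coordinate domains on which unrestricted derivatives make sense.\<close>

lemma chart_image_open:
  assumes A: "smooth_atlas A" and c: "c \<in> A" and S: "open S"
  shows "open (snd c ` (fst c \<inter> S))"
proof -
  have h: "homeomorphism (fst c) (snd c ` fst c) (snd c) (chart_inv c)"
    and o: "open (snd c ` fst c)"
    using A c unfolding smooth_atlas_def by auto
  have "openin (top_of_set (snd c ` fst c)) (snd c ` (fst c \<inter> S))"
    by (rule homeomorphism_imp_open_map[OF h]) (use S in auto)
  then show ?thesis
    using o openin_open_eq by blast
qed

lemma chart_exists:
  assumes "smooth_atlas A"
  obtains c where "c \<in> A" "p \<in> fst c"
  using assms unfolding smooth_atlas_def by blast

text \<open>Transition maps are coordinate expressions of the identity. Hence one chain rule for
  self-maps also covers every change of chart.\<close>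

lemma smooth_self_map_id:
  assumes "smooth_atlas A"
  shows "smooth_self_map A id"
  using assms unfolding smooth_atlas_def smooth_self_map_def by simp

lemma smooth_self_map_differentiable:
  assumes "smooth_atlas A" "smooth_self_map A \<phi>" "c \<in> A" "d \<in> A" "p \<in> fst c" "\<phi> p \<in> fst d"
  shows "(snd d \<circ> \<phi> \<circ> chart_inv c) differentiable (at (snd c p))"
proof (rule smooth_on_open_differentiable)
  show "smooth_on (snd c ` (fst c \<inter> \<phi> -` fst d)) (snd d \<circ> \<phi> \<circ> chart_inv c)"
    using assms unfolding smooth_self_map_def by blast
  have "open (\<phi> -` fst d)"
    using assms open_vimage unfolding smooth_self_map_def smooth_atlas_def by blast
  then show "open (snd c ` (fst c \<inter> \<phi> -` fst d))"
    using assms chart_image_open by blast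
qed (use assms in auto)

text \<open>Near \<open>snd c p\<close> the map \<phi> stays in the domain of \<open>d\<close>,
  where \<open>chart_inv d\<close> undoes \<open>snd d\<close>. There the two coordinate expressions
  compose to that of \<theta> \<circ> \<phi>, and the Euclidean chain rule applies.\<close>

lemma frechet_derivative_chart_comp:
  assumes A: "smooth_atlas A" and \<phi>: "smooth_self_map A \<phi>" and \<theta>: "smooth_self_map A \<theta>"
    and c: "c \<in> A" "p \<in> fst c" and d: "d \<in> A" "\<phi> p \<in> fst d" and e: "e \<in> A" "\<theta> (\<phi> p) \<in> fst e"
  shows "frechet_derivative (snd e \<circ> (\<theta> \<circ> \<phi>) \<circ> chart_inv c) (at (snd c p)) u =
    frechet_derivative (snd e \<circ> \<theta> \<circ> chart_inv d) (at (snd d (\<phi> p)))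
      (frechet_derivative (snd d \<circ> \<phi> \<circ> chart_inv c) (at (snd c p)) u)"
proof -
  let ?g = "snd d \<circ> \<phi> \<circ> chart_inv c" and ?h = "snd e \<circ> \<theta> \<circ> chart_inv d"
  let ?S = "snd c ` (fst c \<inter> \<phi> -` fst d)"
  have gp: "?g (snd c p) = snd d (\<phi> p)"
    using A c by simp
  have "(?g has_derivative frechet_derivative ?g (at (snd c p))) (at (snd c p))"
    using smooth_self_map_differentiable[OF A \<phi> c(1) d(1) c(2) d(2)]
    by (simp add: frechet_derivative_works)
  moreover have "(?h has_derivative frechet_derivative ?h (at (snd d (\<phi> p)))) (at (?g (snd c p)))"
    unfolding gp using smooth_self_map_differentiable[OF A \<theta> d(1) e(1) d(2) e(2)]
    by (simp add: frechet_derivative_works)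
  ultimately have "(?h \<circ> ?g has_derivative
      frechet_derivative ?h (at (snd d (\<phi> p))) \<circ> frechet_derivative ?g (at (snd c p))) (at (snd c p))"
    by (rule diff_chain_at)
  moreover have "open (\<phi> -` fst d)"
    using A \<phi> d open_vimage unfolding smooth_self_map_def smooth_atlas_def by blast
  then have "open ?S"
    using A c chart_image_open by blast
  moreover have "(?h \<circ> ?g) z = (snd e \<circ> (\<theta> \<circ> \<phi>) \<circ> chart_inv c) z" if "z \<in> ?S" for z
    using that A c d by auto
  ultimately have "(snd e \<circ> (\<theta> \<circ> \<phi>) \<circ> chart_inv c has_derivative
      frechet_derivative ?h (at (snd d (\<phi> p))) \<circ> frechet_derivative ?g (at (snd c p))) (at (snd c p))"
    using has_derivative_transform_within_open[of "?h \<circ> ?g" _ _ UNIV ?S] c d by fastforce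
  from fun_cong[OF frechet_derivative_at[OF this], of u] show ?thesis
    by simp
qed

lemma frechet_derivative_chart_id:
  assumes A: "smooth_atlas A" and c: "c \<in> A" "p \<in> fst c"
  shows "frechet_derivative (snd c \<circ> chart_inv c) (at (snd c p)) u = u"
proof -
  have "(snd c \<circ> chart_inv c has_derivative (\<lambda>x. x)) (at (snd c p))"
    by (rule has_derivative_transform_within_open[OF has_derivative_ident, of "snd c ` fst c"])
      (use A c in \<open>auto simp: smooth_atlas_def\<close>)
  from fun_cong[OF frechet_derivative_at[OF this], of u] show ?thesis
    by simp
qed

section \<open>Tangent spaces and their coordinates\<close>

lemma tangent_space_transition:
  assumes "v \<in> tangent_space A p" "c \<in> A" "p \<in> fst c" "d \<in> A" "p \<in> fst d"
  shows "v d = frechet_derivative (snd d \<circ> chart_inv c) (at (snd c p)) (v c)"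
  by (rule conjunct2[OF assms(1)[unfolded tangent_space_def mem_Collect_eq], rule_format,
        OF assms(2,4) conjI[OF assms(3,5)]])

lemma tangent_space_off_charts:
  assumes "v \<in> tangent_space A p" "\<not> (c \<in> A \<and> p \<in> fst c)"
  shows "v c = 0"
  by (rule conjunct1[OF assms(1)[unfolded tangent_space_def mem_Collect_eq], rule_format, OF assms(2)])

lemma tangent_spaceI:
  assumes "\<And>c. \<not> (c \<in> A \<and> p \<in> fst c) \<Longrightarrow> v c = 0"
    and "\<And>c d. c \<in> A \<Longrightarrow> p \<in> fst c \<Longrightarrow> d \<in> A \<Longrightarrow> p \<in> fst d \<Longrightarrow>
      v d = frechet_derivative (snd d \<circ> chart_inv c) (at (snd c p)) (v c)"
  shows "v \<in> tangent_space A p"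
  unfolding tangent_space_def
  by (intro CollectI conjI allI impI ballI) (rule assms, assumption, (elim conjE, rule assms; assumption))

text \<open>The transition rule recovers the coordinates in every chart around \<open>p\<close> from
  those in \<open>c\<close>, and all other values are normalised to 0. One chart therefore suffices
  to compare tangent vectors.\<close>

lemma tangent_space_eqI:
  assumes "u \<in> tangent_space A p" "v \<in> tangent_space A p" "c \<in> A" "p \<in> fst c" "u c = v c"
  shows "u = v"
proof
  fix d
  show "u d = v d"
  proof (cases "d \<in> A \<and> p \<in> fst d")
    case True
    then show ?thesis
      using tangent_space_transition[OF assms(1,3,4), of d]
        tangent_space_transition[OF assms(2,3,4), of d] assms(5) by simp
  next
    case False
    show ?thesis
      using tangent_space_off_charts[OF assms(1) False] tangent_space_off_charts[OF assms(2) False]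
      by simp
  qed
qed

text \<open>This is the cocycle rule for Jacobians of transition maps: the chain rule with both maps
  equal to the identity.\<close>

lemma coord_vec_in_tangent_space:
  assumes A: "smooth_atlas A" and c: "c \<in> A" "p \<in> fst c"
  shows "coord_vec A c p w \<in> tangent_space A p"
proof (rule tangent_spaceI)
  fix d e assume d: "d \<in> A" "p \<in> fst d" and e: "e \<in> A" "p \<in> fst e"
  show "coord_vec A c p w e =
      frechet_derivative (snd e \<circ> chart_inv d) (at (snd d p)) (coord_vec A c p w d)"
    unfolding coord_vec_def
    using frechet_derivative_chart_comp[OF A smooth_self_map_id[OF A] smooth_self_map_id[OF A] c,
        of d e w] d e by simp
qed (auto simp: coord_vec_def)

lemma coord_vec_same_chart:
  assumes "smooth_atlas A" "c \<in> A" "p \<in> fst c"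
  shows "coord_vec A c p w c = w"
  using assms by (simp add: coord_vec_def frechet_derivative_chart_id)

lemma chart_transition_linear:
  assumes A: "smooth_atlas A" and c: "c \<in> A" "d \<in> A" "p \<in> fst c" "p \<in> fst d"
  shows "linear (frechet_derivative (snd d \<circ> chart_inv c) (at (snd c p)))"
  using smooth_self_map_differentiable[OF A smooth_self_map_id[OF A] c(1,2,3)] c(4)
  by (simp add: linear_frechet_derivative)

lemma tangent_space_lincomb:
  assumes A: "smooth_atlas A" and u: "u \<in> tangent_space A p" and v: "v \<in> tangent_space A p"
  shows "(\<lambda>c. a *\<^sub>R u c + b *\<^sub>R v c) \<in> tangent_space A p"
proof (rule tangent_spaceI)
  fix c assume c: "\<not> (c \<in> A \<and> p \<in> fst c)"
  show "a *\<^sub>R u c + b *\<^sub>R v c = 0"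
    by (simp add: tangent_space_off_charts[OF u c] tangent_space_off_charts[OF v c])
next
  fix c d assume c: "c \<in> A" "p \<in> fst c" and d: "d \<in> A" "p \<in> fst d"
  let ?F = "frechet_derivative (snd d \<circ> chart_inv c) (at (snd c p))"
  have F: "linear ?F"
    using chart_transition_linear[OF A] c d by blast
  have "?F (a *\<^sub>R u c + b *\<^sub>R v c) = a *\<^sub>R ?F (u c) + b *\<^sub>R ?F (v c)"
    by (simp only: linear_add[OF F] linear_scale[OF F])
  then show "a *\<^sub>R u d + b *\<^sub>R v d = ?F (a *\<^sub>R u c + b *\<^sub>R v c)"
    by (simp only: tangent_space_transition[OF u c d] tangent_space_transition[OF v c d])
qed

text \<open>Both sides are tangent vectors with the same coordinates in \<open>c\<close>. The rule
  carries bilinear forms on the tangent space over to \<open>real ^ 'n\<close>.\<close>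

lemma coord_vec_lincomb:
  assumes A: "smooth_atlas A" and c: "c \<in> A" "p \<in> fst c"
  shows "coord_vec A c p (a *\<^sub>R u + b *\<^sub>R v) = (\<lambda>d. a *\<^sub>R coord_vec A c p u d + b *\<^sub>R coord_vec A c p v d)"
proof (rule tangent_space_eqI[OF _ _ c])
  show "(\<lambda>d. a *\<^sub>R coord_vec A c p u d + b *\<^sub>R coord_vec A c p v d) \<in> tangent_space A p"
    by (intro tangent_space_lincomb coord_vec_in_tangent_space assms)
qed (simp_all add: coord_vec_in_tangent_space coord_vec_same_chart assms)

section \<open>Differentials of smooth maps\<close>

lemma differential_in_chart:
  assumes A: "smooth_atlas A" and \<phi>: "smooth_self_map A \<phi>" and v: "v \<in> tangent_space A p"
    and c: "c \<in> A" "p \<in> fst c" and d: "d \<in> A" "\<phi> p \<in> fst d"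
  shows "differential A \<phi> p v d = frechet_derivative (snd d \<circ> \<phi> \<circ> chart_inv c) (at (snd c p)) (v c)"
proof -
  \<comment> \<open>\<open>b\<close> is the chart chosen inside \<open>differential\<close>. The
    chain rule for the identity followed by \<phi> absorbs the change of chart from \<open>b\<close>
    to \<open>c\<close>.\<close>
  define b where "b = (SOME c. c \<in> A \<and> p \<in> fst c)"
  have b: "b \<in> A" "p \<in> fst b"
    unfolding b_def using c by (metis (mono_tags, lifting) someI)+
  have "v c = frechet_derivative (snd c \<circ> chart_inv b) (at (snd b p)) (v b)"
    using tangent_space_transition[OF v b c] .
  then have "frechet_derivative (snd d \<circ> \<phi> \<circ> chart_inv c) (at (snd c p)) (v c) =
      frechet_derivative (snd d \<circ> \<phi> \<circ> chart_inv b) (at (snd b p)) (v b)"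
    using frechet_derivative_chart_comp[OF A smooth_self_map_id[OF A] \<phi> b c(1) _ d(1)] c d
    by simp
  then show ?thesis
    unfolding differential_def b_def[symmetric] Let_def using d by simp
qed

text \<open>Coordinates of the image in two charts around \<phi>(p) are related by the chain rule
  for \<phi> followed by the identity.\<close>

lemma differential_in_tangent_space:
  assumes A: "smooth_atlas A" and \<phi>: "smooth_self_map A \<phi>" and v: "v \<in> tangent_space A p"
  shows "differential A \<phi> p v \<in> tangent_space A (\<phi> p)"
proof -
  obtain c where c: "c \<in> A" "p \<in> fst c"
    using A chart_exists by blast
  have "differential A \<phi> p v e =
      frechet_derivative (snd e \<circ> chart_inv d) (at (snd d (\<phi> p))) (differential A \<phi> p v d)"
    if d: "d \<in> A" "\<phi> p \<in> fst d" and e: "e \<in> A" "\<phi> p \<in> fst e" for d e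
    using frechet_derivative_chart_comp[OF A \<phi> smooth_self_map_id[OF A] c d e(1)] e(2)
      differential_in_chart[OF A \<phi> v c d] differential_in_chart[OF A \<phi> v c e] by simp
  moreover have "differential A \<phi> p v d = 0" if "\<not> (d \<in> A \<and> \<phi> p \<in> fst d)" for d
    using that by (auto simp: differential_def Let_def)
  ultimately show ?thesis
    by (intro tangent_spaceI)
qed

lemma differential_surj:
  assumes A: "smooth_atlas A" and \<phi>: "diffeomorphism A \<phi>" and w: "w \<in> tangent_space A (\<phi> p)"
  obtains v where "v \<in> tangent_space A p" "differential A \<phi> p v = w"
proof -
  have b: "bij \<phi>" and s: "smooth_self_map A \<phi>" and s': "smooth_self_map A (inv \<phi>)"
    using \<phi> unfolding diffeomorphism_def by auto
  have i: "inv \<phi> (\<phi> p) = p" and ci: "\<phi> \<circ> inv \<phi> = id"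
    using b bij_is_inj bij_is_surj inv_f_f surj_iff by metis+
  obtain c where c: "c \<in> A" "p \<in> fst c"
    using A chart_exists by blast
  obtain d where d: "d \<in> A" "\<phi> p \<in> fst d"
    using A chart_exists by blast
  \<comment> \<open>The preimage is the image of \<open>w\<close> under the differential of the
    inverse map, written in the charts \<open>d\<close> and \<open>c\<close>.\<close>
  define v where
    "v = coord_vec A c p (frechet_derivative (snd c \<circ> inv \<phi> \<circ> chart_inv d) (at (snd d (\<phi> p))) (w d))"
  have v: "v \<in> tangent_space A p"
    unfolding v_def using A c by (rule coord_vec_in_tangent_space)
  have "differential A \<phi> p v d = frechet_derivative (snd d \<circ> \<phi> \<circ> chart_inv c) (at (snd c p))
      (frechet_derivative (snd c \<circ> inv \<phi> \<circ> chart_inv d) (at (snd d (\<phi> p))) (w d))"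
    using differential_in_chart[OF A s v c d] A c by (simp add: v_def coord_vec_same_chart)
  also have "\<dots> = frechet_derivative (snd d \<circ> (\<phi> \<circ> inv \<phi>) \<circ> chart_inv d) (at (snd d (\<phi> p))) (w d)"
    using frechet_derivative_chart_comp[OF A s' s d c(1) _ d(1)] c d i by simp
  also have "\<dots> = w d"
    unfolding ci using A d by (simp add: frechet_derivative_chart_id)
  finally have "differential A \<phi> p v = w"
    using tangent_space_eqI[OF differential_in_tangent_space[OF A s v] w d] by blast
  then show thesis
    using that v by blast
qed

section \<open>Skew forms in odd dimension\<close>

lemma skew_form_odd_dim_degenerate:
  fixes b :: "real ^ 'n::finite \<Rightarrow> real ^ 'n \<Rightarrow> real"
  assumes n: "odd CARD('n)" and l: "\<And>w. linear (\<lambda>u. b u w)" and skew: "\<And>u w. b u w = - b w u"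
  obtains u where "u \<noteq> 0" "\<And>w. b u w = 0"
proof -
  \<comment> \<open>\<open>T u\<close> lists the values of \<open>b u\<close> on the standard basis,
    so a kernel vector of \<open>T\<close> is annihilated by \<open>b\<close>.\<close>
  define T where "T u = (\<chi> j. b u (axis j 1))" for u
  have T: "linear T"
    by (rule linearI) (simp_all add: T_def vec_eq_iff linear_add[OF l] linear_scale[OF l])
  have entry: "matrix T $ i $ j = b (axis j 1) (axis i 1)" for i j
    by (simp add: matrix_def T_def)
  \<comment> \<open>Skewness makes the transpose the negative of the matrix. Scaling row by row
    yields one factor -1 per row; as transposition preserves the determinant and the dimension is
    odd, the determinant is its own negative.\<close>
  have "transpose (matrix T) $ i $ j = (\<chi> i. (-1) *s (matrix T $ i)) $ i $ j" for i j
    using skew[of "axis i 1" "axis j 1"] by (simp add: transpose_def entry)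
  then have "transpose (matrix T) = (\<chi> i. (-1) *s (matrix T $ i))"
    by (simp add: vec_eq_iff)
  then have "det (transpose (matrix T)) = (-1) ^ CARD('n) * det (matrix T)"
    using det_rows_mul[of "\<lambda>_. -1" "\<lambda>i. matrix T $ i"] by simp
  then have "det (matrix T) = 0"
    using n by simp
  then have "\<not> invertible (matrix T)"
    by (simp add: invertible_det_nz)
  then obtain u where u: "u \<noteq> 0" "matrix T *v u = 0"
    using matrix_left_invertible_ker invertible_left_inverse by blast
  then have Tu: "T u = 0"
    using T by (simp add: matrix_works)
  \<comment> \<open>Linearity in the second argument comes from the first by skewness; it extends
    vanishing on the basis to all vectors.\<close>
  have "linear (b u)"
    using l[of u] skew[of u] linear_compose_neg[of "\<lambda>w. b w u"] by presburger
  moreover have "b u x = 0" if x: "x \<in> Basis" for x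
  proof -
    obtain i where "x = axis i 1"
      using x by (auto simp: Basis_vec_def)
    then have "b u x = T u $ i"
      by (simp add: T_def)
    then show ?thesis
      using Tu by simp
  qed
  ultimately have "b u w = 0" for w
    using linear_eq_stdbasis[of "b u" "\<lambda>_. 0"] by (auto simp: linear_zero)
  then show thesis
    using that u by blast
qed

section \<open>Linear algebra of the Reeb field at a point\<close>

context
  fixes A :: "('a::{t2_space, second_countable_topology}, 'n::finite) chart set"
    and \<omega> :: "'a \<Rightarrow> ('a, 'n) tvec \<Rightarrow> ('a, 'n) tvec \<Rightarrow> real"
    and \<eta> :: "'a \<Rightarrow> ('a, 'n) tvec \<Rightarrow> real"
  assumes cosymp: "cosymplectic_manifold A \<omega> \<eta>"
begin

lemma cosymp_atlas: "smooth_atlas A"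
  using cosymp unfolding cosymplectic_manifold_def by blast

lemma eta_cotangent: "\<eta> p \<in> cotangent_space A p"
  using cosymp unfolding cosymplectic_manifold_def closed_one_form_def one_form_def by blast

lemma eta_lincomb:
  assumes "u \<in> tangent_space A p" "v \<in> tangent_space A p"
  shows "\<eta> p (\<lambda>c. a *\<^sub>R u c + b *\<^sub>R v c) = a * \<eta> p u + b * \<eta> p v"
  using eta_cotangent[of p] assms unfolding cotangent_space_def by blast

lemma omega_skew:
  assumes "u \<in> tangent_space A p" "v \<in> tangent_space A p"
  shows "\<omega> p u v = - \<omega> p v u"
  using assms cosymp
  unfolding cosymplectic_manifold_def closed_two_form_def two_form_def by blast

lemma omega_lincomb_right:
  assumes "u \<in> tangent_space A p" "v \<in> tangent_space A p" "w \<in> tangent_space A p"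
  shows "\<omega> p w (\<lambda>c. a *\<^sub>R u c + b *\<^sub>R v c) = a * \<omega> p w u + b * \<omega> p w v"
proof -
  have "\<omega> p w \<in> cotangent_space A p"
    using assms cosymp
    unfolding cosymplectic_manifold_def closed_two_form_def two_form_def by blast
  then show ?thesis
    using assms unfolding cotangent_space_def by blast
qed

lemma omega_lincomb_left:
  assumes "u \<in> tangent_space A p" "v \<in> tangent_space A p" "w \<in> tangent_space A p"
  shows "\<omega> p (\<lambda>c. a *\<^sub>R u c + b *\<^sub>R v c) w = a * \<omega> p u w + b * \<omega> p v w"
  using omega_lincomb_right[OF assms, of a b] omega_skew[OF assms(1,3)] omega_skew[OF assms(2,3)]
    omega_skew[OF tangent_space_lincomb[OF cosymp_atlas assms(1,2), of a b] assms(3)] by simp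

lemma cosymp_map_bij: "bij_betw (cosymp_map A \<omega> \<eta> p) (tangent_space A p) (cotangent_space A p)"
  using cosymp unfolding cosymplectic_manifold_def by blast

text \<open>The covectors \<open>cosymp_map\<close> produces are restricted to the tangent space, so
  agreement on tangent vectors makes them equal as functions. This is the uniqueness principle for
  identifying vectors below.\<close>

lemma cosymp_map_inject:
  assumes "u \<in> tangent_space A p" "v \<in> tangent_space A p"
    and "\<And>w. w \<in> tangent_space A p \<Longrightarrow> \<omega> p u w + \<eta> p u * \<eta> p w = \<omega> p v w + \<eta> p v * \<eta> p w"
  shows "u = v"
proof -
  have "cosymp_map A \<omega> \<eta> p u = cosymp_map A \<omega> \<eta> p v"
    unfolding cosymp_map_def using assms(3) by (auto intro: restrict_ext)
  then show ?thesis
    using cosymp_map_bij[of p] assms(1,2) unfolding bij_betw_def inj_on_def by blast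
qed

text \<open>In a chart, \<omega> becomes a skew bilinear form on a space of odd dimension and is
  degenerate. Every tangent vector is the \<open>coord_vec\<close> of its coordinates, so the kernel
  vector annihilates the whole tangent space.\<close>

lemma omega_kernel:
  obtains v where "v \<in> tangent_space A p" "v \<noteq> (\<lambda>_. 0)" "\<And>w. w \<in> tangent_space A p \<Longrightarrow> \<omega> p v w = 0"
proof -
  obtain c where c: "c \<in> A" "p \<in> fst c"
    using cosymp_atlas chart_exists by blast
  note cv = coord_vec_in_tangent_space[OF cosymp_atlas c]
  define b where "b u w = \<omega> p (coord_vec A c p u) (coord_vec A c p w)" for u w
  have lc: "b (x *\<^sub>R u + y *\<^sub>R v) w = x * b u w + y * b v w" for x y u v w
    unfolding b_def coord_vec_lincomb[OF cosymp_atlas c] by (intro omega_lincomb_left cv)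
  \<comment> \<open>Coefficients 1 and 1 give additivity; a zero second term gives
    homogeneity.\<close>
  have "linear (\<lambda>u. b u w)" for w
    using lc[of 1 _ 1 _ w] lc[of _ _ 0 0 w] by (auto simp: linear_iff)
  moreover have "b u w = - b w u" for u w
    unfolding b_def by (intro omega_skew cv)
  moreover have "odd CARD('n)"
    using cosymp unfolding cosymplectic_manifold_def by blast
  ultimately obtain u where u: "u \<noteq> 0" "\<And>w. b u w = 0"
    using skew_form_odd_dim_degenerate[of b] by blast
  have "coord_vec A c p u c \<noteq> 0"
    using u(1) by (simp add: coord_vec_same_chart[OF cosymp_atlas c])
  then have "coord_vec A c p u \<noteq> (\<lambda>_. 0)"
    by metis
  moreover have "\<omega> p (coord_vec A c p u) w = 0" if w: "w \<in> tangent_space A p" for w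
  proof -
    have "coord_vec A c p (w c) = w"
      using tangent_space_eqI[OF cv w c] coord_vec_same_chart[OF cosymp_atlas c] by blast
    then show ?thesis
      using u(2)[of "w c"] by (simp add: b_def)
  qed
  ultimately show thesis
    using that cv by blast
qed

text \<open>\<open>inv_into\<close> returns a genuine preimage because \<eta> at \<open>p\<close>
  lies in the cotangent space, which is the image of \<open>cosymp_map\<close>.\<close>

lemma reeb_field_in_tangent_space: "reeb_field A \<omega> \<eta> p \<in> tangent_space A p"
  unfolding reeb_field_def
  using cosymp_map_bij[of p] eta_cotangent[of p] by (metis bij_betw_def inv_into_into)

lemma reeb_field_eq:
  assumes "w \<in> tangent_space A p"
  shows "\<omega> p (reeb_field A \<omega> \<eta> p) w + \<eta> p (reeb_field A \<omega> \<eta> p) * \<eta> p w = \<eta> p w"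
proof -
  have "cosymp_map A \<omega> \<eta> p (reeb_field A \<omega> \<eta> p) = \<eta> p"
    unfolding reeb_field_def
    using cosymp_map_bij[of p] eta_cotangent[of p] by (metis bij_betw_def f_inv_into_f)
  from fun_cong[OF this, of w] show ?thesis
    using assms by (simp add: cosymp_map_def)
qed

text \<open>Evaluating the defining equation at \<open>\<xi>\<close> gives \<open>\<eta>(\<xi>)\<^sup>2 = \<eta>(\<xi>)\<close>; the value \<open>0\<close> is impossible,
  since then \<open>\<eta> = \<iota>\<^sub>\<xi> \<omega>\<close> vanishes on the kernel of \<open>\<omega>\<close>, which is nonzero in odd dimension.\<close>

lemma eta_reeb_field: "\<eta> p (reeb_field A \<omega> \<eta> p) = 1"
proof (rule ccontr)
  let ?\<xi> = "reeb_field A \<omega> \<eta> p"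
  note \<xi> = reeb_field_in_tangent_space[of p]
  assume "\<eta> p ?\<xi> \<noteq> 1"
  moreover have "\<omega> p ?\<xi> ?\<xi> = 0"
    using omega_skew[OF \<xi> \<xi>] by simp
  ultimately have 0: "\<eta> p ?\<xi> = 0"
    using reeb_field_eq[OF \<xi>] by simp
  obtain v where v: "v \<in> tangent_space A p" "v \<noteq> (\<lambda>_. 0)"
    "\<And>w. w \<in> tangent_space A p \<Longrightarrow> \<omega> p v w = 0"
    using omega_kernel by blast
  have "\<eta> p v = 0"
    using reeb_field_eq[OF v(1)] 0 omega_skew[OF \<xi> v(1)] v(3)[OF \<xi>] by simp
  moreover have "(\<lambda>_. 0) \<in> tangent_space A p"
    using tangent_space_lincomb[OF cosymp_atlas v(1) v(1), of 0 0] by simp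
  moreover have "\<eta> p (\<lambda>_. 0) = 0" "\<And>w. w \<in> tangent_space A p \<Longrightarrow> \<omega> p (\<lambda>_. 0) w = 0"
    using eta_lincomb[OF v(1) v(1), of 0 0] omega_lincomb_left[OF v(1) v(1), of _ 0 0] by simp_all
  \<comment> \<open>Both the kernel vector and the zero vector are sent to the zero covector, so
    injectivity identifies them.\<close>
  ultimately have "v = (\<lambda>_. 0)"
    using v(1,3) by (intro cosymp_map_inject[of v p]) auto
  then show False
    using v(2) by contradiction
qed

lemma omega_reeb_field:
  assumes "w \<in> tangent_space A p"
  shows "\<omega> p (reeb_field A \<omega> \<eta> p) w = 0"
  using reeb_field_eq[OF assms] eta_reeb_field by simp

text \<open>The factor \<open>g\<close> is left arbitrary so that the constant 1 and the exponential
  of \<open>f\<close> are both instances.\<close>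

lemma push_forward_reeb_field:
  assumes \<psi>: "diffeomorphism A \<psi>" and \<omega>: "pull_back2 A \<psi> \<omega> = \<omega>"
    and \<eta>: "pull_back1 A \<psi> \<eta> = fun_times_form1 A g \<eta>"
  shows "push_forward A \<psi> (reeb_field A \<omega> \<eta>) = fun_times_field (\<lambda>p. g (inv \<psi> p)) (reeb_field A \<omega> \<eta>)"
proof
  fix q
  define p where "p = inv \<psi> q"
  have q: "q = \<psi> p"
    using \<psi> unfolding p_def diffeomorphism_def by (simp add: bij_is_surj surj_f_inv_f)
  let ?\<xi> = "reeb_field A \<omega> \<eta>" and ?D = "differential A \<psi> p"
  note \<xi> = reeb_field_in_tangent_space
  have D: "?D v \<in> tangent_space A q" if "v \<in> tangent_space A p" for v
    using that differential_in_tangent_space[OF cosymp_atlas] \<psi> q unfolding diffeomorphism_def by blast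
  have g\<xi>: "(\<lambda>c. g p *\<^sub>R ?\<xi> q c) \<in> tangent_space A q"
    using tangent_space_lincomb[OF cosymp_atlas \<xi> \<xi>, of "g p" q 0] by simp
  have \<omega>D: "\<omega> q (?D u) (?D v) = \<omega> p u v" if "u \<in> tangent_space A p" "v \<in> tangent_space A p" for u v
    using that fun_cong[OF fun_cong[OF fun_cong[OF \<omega>]], of p u v] by (simp add: pull_back2_def q)
  have \<eta>D: "\<eta> q (?D v) = g p * \<eta> p v" if "v \<in> tangent_space A p" for v
    using that fun_cong[OF fun_cong[OF \<eta>], of p v] by (simp add: pull_back1_def fun_times_form1_def q)
  have "?D (?\<xi> p) = (\<lambda>c. g p *\<^sub>R ?\<xi> q c)"
  proof (rule cosymp_map_inject[OF D[OF \<xi>] g\<xi>])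
    fix w assume w: "w \<in> tangent_space A q"
    \<comment> \<open>The pull-back equations evaluate forms on images under the differential, so
      the test vector is first written as such an image.\<close>
    then obtain v where v: "v \<in> tangent_space A p" "w = ?D v"
      using differential_surj[OF cosymp_atlas \<psi>] q by metis
    have "\<omega> q (?D (?\<xi> p)) w = 0"
      using \<omega>D[OF \<xi> v(1)] omega_reeb_field v by simp
    moreover have "\<eta> q (?D (?\<xi> p)) = g p"
      using \<eta>D[OF \<xi>] eta_reeb_field by simp
    moreover have "\<omega> q (\<lambda>c. g p *\<^sub>R ?\<xi> q c) w = 0"
      using omega_lincomb_left[OF \<xi> \<xi> w, of "g p" 0] omega_reeb_field[OF w] by simp
    moreover have "\<eta> q (\<lambda>c. g p *\<^sub>R ?\<xi> q c) = g p"
      using eta_lincomb[OF \<xi> \<xi>, of q "g p" 0] eta_reeb_field by simp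
    \<comment> \<open>Both sides reduce to \<open>g p * \<eta> q w\<close>.\<close>
    ultimately show "\<omega> q (?D (?\<xi> p)) w + \<eta> q (?D (?\<xi> p)) * \<eta> q w =
        \<omega> q (\<lambda>c. g p *\<^sub>R ?\<xi> q c) w + \<eta> q (\<lambda>c. g p *\<^sub>R ?\<xi> q c) * \<eta> q w"
      by simp
  qed
  then show "push_forward A \<psi> ?\<xi> q = fun_times_field (\<lambda>p. g (inv \<psi> p)) ?\<xi> q"
    unfolding push_forward_def fun_times_field_def p_def by simp
qed

end

theorem lemma4p1:
  fixes A :: "('a::{t2_space, second_countable_topology}, 'n::finite) chart set"
    and \<omega> :: "'a \<Rightarrow> ('a, 'n) tvec \<Rightarrow> ('a, 'n) tvec \<Rightarrow> real"
    and \<eta> :: "'a \<Rightarrow> ('a, 'n) tvec \<Rightarrow> real"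
  assumes "cosymplectic_manifold A \<omega> \<eta>"
  shows "(\<forall>\<phi> \<in> G_cosymp A \<omega> \<eta>.
            push_forward A \<phi> (reeb_field A \<omega> \<eta>) = reeb_field A \<omega> \<eta>)
       \<and> (\<forall>\<psi> \<in> AG_cosymp A \<omega> \<eta>. \<forall>f.
            smooth_fun A f \<and> pull_back1 A \<psi> \<eta> = fun_times_form1 A (\<lambda>p. exp (f p)) \<eta> \<longrightarrow>
            push_forward A \<psi> (reeb_field A \<omega> \<eta>)
              = fun_times_field (\<lambda>p. exp (f (inv \<psi> p))) (reeb_field A \<omega> \<eta>))"
proof (intro conjI ballI allI impI)
  fix \<phi> assume "\<phi> \<in> G_cosymp A \<omega> \<eta>"
  then have \<phi>: "diffeomorphism A \<phi>" "pull_back2 A \<phi> \<omega> = \<omega>" "pull_back1 A \<phi> \<eta> = \<eta>"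
    unfolding G_cosymp_def cosymplectic_diffeo_def by auto
  \<comment> \<open>Multiplication by 1 restricts each covector to the tangent space; this changes
    nothing because \<eta> is extensional there.\<close>
  have "\<eta> = fun_times_form1 A (\<lambda>_. 1) \<eta>"
  proof
    fix p
    have "\<eta> p \<in> extensional (tangent_space A p)"
      using eta_cotangent[OF assms] unfolding cotangent_space_def by blast
    then show "\<eta> p = fun_times_form1 A (\<lambda>_. 1) \<eta> p"
      unfolding fun_times_form1_def by (simp add: extensional_restrict)
  qed
  then have "pull_back1 A \<phi> \<eta> = fun_times_form1 A (\<lambda>_. 1) \<eta>"
    using \<phi>(3) by simp
  then show "push_forward A \<phi> (reeb_field A \<omega> \<eta>) = reeb_field A \<omega> \<eta>"
    using push_forward_reeb_field[OF assms \<phi>(1,2), of "\<lambda>_. 1"] by (simp add: fun_times_field_def)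
next
  fix \<psi> f
  assume "\<psi> \<in> AG_cosymp A \<omega> \<eta>"
    and f: "smooth_fun A f \<and> pull_back1 A \<psi> \<eta> = fun_times_form1 A (\<lambda>p. exp (f p)) \<eta>"
  \<comment> \<open>The condition on the isotopy at time 1 gives these two facts. The conformal
    factor is taken from the given \<open>f\<close>, not from the existential in
    \<open>almost_cosymplectic_diffeo\<close>.\<close>
  then have "diffeomorphism A \<psi>" "pull_back2 A \<psi> \<omega> = \<omega>"
    unfolding AG_cosymp_def almost_cosymplectic_diffeo_def by auto
  then show "push_forward A \<psi> (reeb_field A \<omega> \<eta>)
      = fun_times_field (\<lambda>p. exp (f (inv \<psi> p))) (reeb_field A \<omega> \<eta>)"
    using push_forward_reeb_field[OF assms _ _ conjunct2[OF f]] by blast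
qed

end
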